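(* Let $\kappa$ be a cardinal and let $K\subseteq 2^\kappa$ be a compact space satisfying the countable chain condition. Let \[\widetilde{K}=\{x\in 2^\kappa:\ \text{there is } y\in K \text{ with } x(\alpha)\le y(\alpha)\text{ for all }\alpha<\kappa\}\] be the adequate closure of $K$. Then $\widetilde K$ belongs to $\mathrm{WRNB}^\perp$, i.e. the Boolean algebra of clopen subsets of $\widetilde K$ contains no uncountable subalgebra whose Stone space is weakly Radon-Nikodým.
   Context: A compact space is ccc if it contains no uncountable family of pairwise disjoint nonempty open sets. A compact space is weakly Radon-Nikodým (WRN) if it is homeomorphic to a weak$^*$ compact subset of the dual $X^*$ of a Banach space $X$ containing no isomorphic copy of $\ell_1$. A Boolean algebra is WRN if its Stone space is WRN. For a class $\mathcal C$ of Boolean algebras, $\mathcal C^\perp$ is the class of Boolean algebras containing no uncountable subalgebra in $\mathcal C$; a zero-dimensional compact space is said to belong to $\mathrm{WRNB}^\perp$ if its algebra of clopen sets belongs to $\mathrm{WRNB}^\perp$, where $\mathrm{WRNB}$ is the class of WRN Boolean algebras. *)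

theory Defs
  imports "HOL-Analysis.Analysis"
begin

text \<open>The cardinal kappa is represented by an arbitrary index type 'k; points of 2^kappa are
  functions 'k => bool, with the product of the discrete two-point spaces.\<close>

definition cantor_cube :: "('k \<Rightarrow> bool) topology" where
  "cantor_cube = product_topology (\<lambda>_. discrete_topology (UNIV :: bool set)) UNIV"

definition adequate_closure :: "('k \<Rightarrow> bool) set \<Rightarrow> ('k \<Rightarrow> bool) set" where
  "adequate_closure K = {x. \<exists>y\<in>K. \<forall>\<alpha>. x \<alpha> \<le> y \<alpha>}"

definition ccc_space :: "'a topology \<Rightarrow> bool" where
  "ccc_space X \<longleftrightarrow>
     (\<forall>\<F>. (\<forall>U\<in>\<F>. openin X U \<and> U \<noteq> {}) \<and> pairwise disjnt \<F> \<longrightarrow> countable \<F>)"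

definition clopens :: "'a topology \<Rightarrow> 'a set set" where
  "clopens X = {U. closedin X U \<and> openin X U}"

definition clopen_subalgebra :: "'a topology \<Rightarrow> 'a set set \<Rightarrow> bool" where
  "clopen_subalgebra X B \<longleftrightarrow>
     B \<subseteq> clopens X \<and> {} \<in> B \<and> topspace X \<in> B \<and>
     (\<forall>a\<in>B. \<forall>b\<in>B. a \<union> b \<in> B) \<and> (\<forall>a\<in>B. topspace X - a \<in> B)"

definition ultrafilters :: "'a set \<Rightarrow> 'a set set \<Rightarrow> 'a set set set" where
  "ultrafilters S B = {U. U \<subseteq> B \<and> S \<in> U \<and> {} \<notin> U \<and>
      (\<forall>a\<in>U. \<forall>b\<in>B. a \<subseteq> b \<longrightarrow> b \<in> U) \<and>
      (\<forall>a\<in>U. \<forall>b\<in>U. a \<inter> b \<in> U) \<and>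
      (\<forall>b\<in>B. b \<in> U \<or> S - b \<in> U)}"

definition stone_space :: "'a set \<Rightarrow> 'a set set \<Rightarrow> 'a set set topology" where
  "stone_space S B = topology_generated_by {{U \<in> ultrafilters S B. b \<in> U} | b. b \<in> B}"

definition weak_star_topology :: "('x::real_normed_vector \<Rightarrow>\<^sub>L real) topology" where
  "weak_star_topology =
     pullback_topology UNIV (\<lambda>f x. blinfun_apply f x) (product_topology (\<lambda>_. euclideanreal) UNIV)"

definition ell1 :: "(nat \<Rightarrow> real) set" where
  "ell1 = {a. summable (\<lambda>n. \<bar>a n\<bar>)}"

definition ell1_norm :: "(nat \<Rightarrow> real) \<Rightarrow> real" where
  "ell1_norm a = (\<Sum>n. \<bar>a n\<bar>)"

definition contains_ell1 :: "'x::real_normed_vector itself \<Rightarrow> bool" where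
  "contains_ell1 _ \<longleftrightarrow> (\<exists>(T :: (nat \<Rightarrow> real) \<Rightarrow> 'x) c C. c > 0 \<and>
      (\<forall>a\<in>ell1. \<forall>b\<in>ell1. T (\<lambda>n. a n + b n) = T a + T b) \<and>
      (\<forall>a\<in>ell1. \<forall>r. T (\<lambda>n. r * a n) = r *\<^sub>R T a) \<and>
      (\<forall>a\<in>ell1. c * ell1_norm a \<le> norm (T a) \<and> norm (T a) \<le> C * ell1_norm a))"

text \<open>The topological space Y is WRN as witnessed by the Banach space 'x: 'x contains no copy
  of l1 and Y is homeomorphic to a weak* compact subset of the dual of 'x.  A space is WRN iff
  this holds for SOME Banach space 'x; since WRN occurs negatively in the theorem, the
  quantification over Banach spaces becomes universal over the type variable 'x.\<close>
definition WRN_via :: "'x::banach itself \<Rightarrow> 'a topology \<Rightarrow> bool" where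
  "WRN_via t Y \<longleftrightarrow> \<not> contains_ell1 t \<and>
     (\<exists>L. compactin (weak_star_topology :: ('x \<Rightarrow>\<^sub>L real) topology) L \<and>
          Y homeomorphic_space subtopology weak_star_topology L)"

end

theory Submission
  imports Defs
begin

text \<open>
  Let \<open>S\<close> be the adequate closure of \<open>K\<close>, and let \<open>B\<close> be an uncountable subalgebra whose Stone
  space is a weak* compact subset \<open>L\<close> of the dual of a Banach space. Each vector \<open>v\<close> gives a continuous
  function \<open>f v\<close> on \<open>S\<close>, and by compactness each \<open>b \<in> B\<close> is separated from its complement, with a
  uniform gap \<open>e\<close>, by finitely many vectors. Up to a small oscillation these functions depend on a
  finite set \<open>F b\<close> of coordinates. Pass to a Delta-system with root \<open>R\<close>. All but finitely many \<open>b\<close>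
  separate two points of \<open>S\<close> that agree on \<open>R\<close>; since \<open>S\<close> is closed downwards, one of the two points
  may be taken to be a point \<open>z\<close> vanishing off \<open>R\<close>; call the other \<open>w b\<close>. By the countable chain
  condition, some \<open>y \<in> K\<close> dominates \<open>w b\<close> on \<open>F b\<close> for infinitely many \<open>b\<close>. Everything below \<open>y\<close> lies
  in \<open>S\<close>, so \<open>w b\<close> and \<open>z\<close> can be prescribed independently on the sets \<open>F b\<close>. Hence the separating
  vectors are an independent sequence of functions on \<open>L\<close>, which spans a copy of \<open>\<ell>\<^sub>1\<close>.
\<close>

subsection \<open>Uncountable families\<close>

lemma uncountable_fibre:
  fixes f :: "'a \<Rightarrow> 'b"
  assumes "uncountable I" "countable C" "f ` I \<subseteq> C"
  obtains c where "c \<in> C" "uncountable {i\<in>I. f i = c}"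
proof -
  have "I = (\<Union>c\<in>C. {i\<in>I. f i = c})"
    using assms(3) by auto
  then show ?thesis
    using assms(1,2) that by (metis (no_types, lifting) countable_UN)
qed

text \<open>Zorn's lemma gives a maximal pairwise unrelated \<open>J\<close>. By maximality every
  index is in \<open>J\<close> or related to a member of \<open>J\<close>, so a countable
  \<open>J\<close> would make \<open>I\<close> countable.\<close>

lemma uncountable_unrelated_subset:
  assumes unc: "uncountable I"
    and sym: "\<And>i j. i \<in> I \<Longrightarrow> j \<in> I \<Longrightarrow> r i j \<Longrightarrow> r j i"
    and cnt: "\<And>i. i \<in> I \<Longrightarrow> countable {j\<in>I. r i j}"
  obtains J where "J \<subseteq> I" "uncountable J" "pairwise (\<lambda>i j. \<not> r i j) J"
proof -
  let ?A = "{J. J \<subseteq> I \<and> pairwise (\<lambda>i j. \<not> r i j) J}"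
  have "\<exists>M\<in>?A. \<forall>X\<in>?A. M \<subseteq> X \<longrightarrow> X = M"
  proof (rule subset_Zorn')
    fix C assume C: "subset.chain ?A C"
    then have "pairwise (\<lambda>i j. \<not> r i j) (\<Union>C)"
      by (intro pairwise_chain_Union) (auto simp: subset_chain_def chain_subset_def)
    with C show "\<Union>C \<in> ?A"
      by (auto simp: subset_chain_def)
  qed
  then obtain J where J: "J \<subseteq> I" "pairwise (\<lambda>i j. \<not> r i j) J"
    and max: "\<And>X. X \<subseteq> I \<Longrightarrow> pairwise (\<lambda>i j. \<not> r i j) X \<Longrightarrow> J \<subseteq> X \<Longrightarrow> X = J"
    by auto
  have "I \<subseteq> J \<union> (\<Union>i\<in>J. {j\<in>I. r i j})"
  proof
    fix j assume j: "j \<in> I"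
    show "j \<in> J \<union> (\<Union>i\<in>J. {j\<in>I. r i j})"
    proof (rule ccontr)
      assume n: "\<not> ?thesis"
      have "pairwise (\<lambda>i j. \<not> r i j) (insert j J)"
        using J n j sym by (auto simp: pairwise_insert)
      then show False
        using max[of "insert j J"] n j J by auto
    qed
  qed
  moreover have "countable (J \<union> (\<Union>i\<in>J. {j\<in>I. r i j}))" if "countable J"
    using that cnt J(1) by (intro countable_Un countable_UN) auto
  ultimately have "uncountable J"
    using unc countable_subset by blast
  with J that show thesis by blast
qed

text \<open>Induction on the size. A point lying in uncountably many sets is removed and put back
  into the root afterwards. If there is no such point, each set meets only countably many others,
  and some uncountable subfamily is disjoint. The family is indexed, so equal sets at different
  indices are allowed.\<close>

lemma delta_system_card:
  assumes "uncountable I" "\<And>i. i \<in> I \<Longrightarrow> finite (F i) \<and> card (F i) = n"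
  shows "\<exists>J R. J \<subseteq> I \<and> uncountable J \<and> pairwise (\<lambda>i j. F i \<inter> F j = R) J"
  using assms
proof (induction n arbitrary: F I)
  case 0
  then have "F i = {}" if "i \<in> I" for i
    using that by (metis card_0_eq)
  then have "pairwise (\<lambda>i j. F i \<inter> F j = {}) I"
    by (simp add: pairwise_def)
  with "0.prems" show ?case by blast
next
  case (Suc n)
  show ?case
  proof (cases "\<exists>a. uncountable {i\<in>I. a \<in> F i}")
    case True
    then obtain a where a: "uncountable {i\<in>I. a \<in> F i}" by blast
    have "\<exists>J R. J \<subseteq> {i\<in>I. a \<in> F i} \<and> uncountable J \<and>
        pairwise (\<lambda>i j. (F i - {a}) \<inter> (F j - {a}) = R) J"
      using Suc.prems(2) by (intro Suc.IH a) auto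
    then obtain J R where J: "J \<subseteq> {i\<in>I. a \<in> F i}" "uncountable J"
        "pairwise (\<lambda>i j. (F i - {a}) \<inter> (F j - {a}) = R) J"
      by blast
    have "pairwise (\<lambda>i j. F i \<inter> F j = insert a R) J"
      using J(1,3) unfolding pairwise_def by blast
    with J show ?thesis by blast
  next
    case False
    have cnt: "countable {j\<in>I. F i \<inter> F j \<noteq> {}}" if "i \<in> I" for i
    proof -
      have "{j\<in>I. F i \<inter> F j \<noteq> {}} = (\<Union>a\<in>F i. {j\<in>I. a \<in> F j})"
        by auto
      moreover have "countable (\<Union>a\<in>F i. {j\<in>I. a \<in> F j})"
        using False Suc.prems(2)[OF that] by (intro countable_UN[OF countable_finite]) auto
      ultimately show ?thesis by simp
    qed
    have sym: "F j \<inter> F i \<noteq> {}" if "F i \<inter> F j \<noteq> {}" for i j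
      using that by auto
    obtain J where "J \<subseteq> I" "uncountable J" "pairwise (\<lambda>i j. \<not> F i \<inter> F j \<noteq> {}) J"
      by (rule uncountable_unrelated_subset[OF Suc.prems(1) sym cnt])
    then show ?thesis by auto
  qed
qed

text \<open>Uncountably many of the sets have the same cardinality. The root lies inside each member
  because a second index is always available.\<close>

lemma delta_system:
  assumes "uncountable I" "\<And>i. i \<in> I \<Longrightarrow> finite (F i)"
  obtains J R where "J \<subseteq> I" "uncountable J" "finite R" "\<And>i. i \<in> J \<Longrightarrow> R \<subseteq> F i"
    "pairwise (\<lambda>i j. F i \<inter> F j = R) J"
proof -
  obtain n where n: "uncountable {i\<in>I. card (F i) = n}"
    using uncountable_fibre[OF assms(1), of UNIV "\<lambda>i. card (F i)"] by auto
  obtain J R where J: "J \<subseteq> {i\<in>I. card (F i) = n}" "uncountable J"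
      and R: "pairwise (\<lambda>i j. F i \<inter> F j = R) J"
    using delta_system_card[OF n, of F n] assms(2) by auto
  have sub: "R \<subseteq> F i" if "i \<in> J" for i
  proof -
    have "J - {i} \<noteq> {}"
      using J(2) by (metis countable_empty uncountable_minus_countable countable_finite finite.emptyI finite.insertI)
    then obtain j where "j \<in> J" "j \<noteq> i" by blast
    then show ?thesis using R that by (auto simp: pairwise_def)
  qed
  obtain i where "i \<in> J" using J(2) by (metis countable_empty ex_in_conv)
  then have "R \<subseteq> F i" "finite (F i)"
    using sub assms(2) J(1) by auto
  then have "finite R"
    by (rule finite_subset)
  then show thesis using J R sub that by blast
qed

text \<open>A finite index set is \<open>good\<close> if uncountably many \<open>U i\<close> meet
  its intersection. Good sets grow one index at a time, which gives a sequence with the finite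
  intersection property; compactness then supplies the common point.\<close>

lemma ccc_infinitely_many_with_common_point:
  assumes ccc: "ccc_space X" and cpt: "compact_space X" and unc: "uncountable I"
    and U: "\<And>i. i \<in> I \<Longrightarrow> openin X (U i) \<and> closedin X (U i) \<and> U i \<noteq> {}"
  obtains y and s :: "nat \<Rightarrow> 'i" where "inj s" "range s \<subseteq> I" "y \<in> topspace X" "\<And>n. y \<in> U (s n)"
proof -
  define T where "T S = topspace X \<inter> (\<Inter>i\<in>S. U i)" for S
  define good where "good S \<longleftrightarrow> finite S \<and> S \<subseteq> I \<and> uncountable {i\<in>I. T (insert i S) \<noteq> {}}" for S
  have good_empty: "good {}"
  proof -
    have "{i\<in>I. T {i} \<noteq> {}} = I"
      using U openin_subset by (fastforce simp: T_def)
    then show ?thesis using unc by (simp add: good_def)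
  qed
  \<comment> \<open>If no index extends \<open>S\<close>, each \<open>T (insert i S)\<close> meets
    only countably many \<open>U j\<close>. An unrelated subfamily then consists of uncountably many
    disjoint nonempty open sets, contrary to ccc.\<close>
  have step: "\<exists>i. i \<notin> S \<and> good (insert i S)" if S: "good S" for S
  proof (rule ccontr)
    assume no: "\<not> ?thesis"
    define I' where "I' = {i\<in>I. T (insert i S) \<noteq> {}} - S"
    have fin: "finite S" "S \<subseteq> I" and unc': "uncountable I'"
      using S uncountable_minus_countable[OF _ countable_finite] by (auto simp: good_def I'_def)
    have cnt: "countable {j\<in>I'. T (insert i S) \<inter> U j \<noteq> {}}" if i: "i \<in> I'" for i
    proof -
      have "countable {j\<in>I. T (insert j (insert i S)) \<noteq> {}}"
        using no i fin by (auto simp: good_def I'_def)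
      then show ?thesis
        by (rule countable_subset[rotated]) (auto simp: I'_def T_def)
    qed
    have sym: "T (insert j S) \<inter> U i \<noteq> {}" if "T (insert i S) \<inter> U j \<noteq> {}" for i j
      using that by (auto simp: T_def)
    obtain J where J: "J \<subseteq> I'" "uncountable J"
        and disj: "pairwise (\<lambda>i j. \<not> T (insert i S) \<inter> U j \<noteq> {}) J"
      by (rule uncountable_unrelated_subset[OF unc' sym cnt])
    define W where "W i = T (insert i S)" for i
    have ne: "W i \<noteq> {}" if "i \<in> J" for i
      using that J(1) by (auto simp: I'_def W_def)
    have dW: "W i \<inter> W j = {}" if "i \<in> J" "j \<in> J" "i \<noteq> j" for i j
      using disj that by (auto simp: pairwise_def W_def T_def)
    have "openin X (W i)" if "i \<in> J" for i
    proof -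
      have "W i = topspace X \<inter> \<Inter>(U ` insert i S)"
        by (simp add: W_def T_def)
      moreover have "openin X (topspace X \<inter> \<Inter>(U ` insert i S))"
        using U fin J(1) that by (intro openin_Int_Inter) (auto simp: I'_def)
      ultimately show ?thesis by simp
    qed
    moreover have "pairwise disjnt (W ` J)"
      using dW by (auto simp: pairwise_def disjnt_def)
    ultimately have "countable (W ` J)"
      using ccc ne unfolding ccc_space_def by blast
    \<comment> \<open>\<open>ccc_space\<close> counts sets, not indices; the \<open>W i\<close> are
      disjoint and nonempty, so different indices give different sets.\<close>
    moreover have "inj_on W J"
      using dW ne by (metis inf.idem inj_onI)
    ultimately show False
      using J(2) countable_image_inj_on by blast
  qed
  have "\<exists>f. \<forall>n. good (f n) \<and> (\<exists>i. i \<notin> f n \<and> f (Suc n) = insert i (f n))"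
  proof (rule dependent_nat_choice)
    show "\<exists>S. good S" using good_empty by blast
    show "\<exists>S'. good S' \<and> (\<exists>i. i \<notin> S \<and> S' = insert i S)" if "good S" for S
      using step[OF that] by blast
  qed
  then obtain f i where f: "\<And>n. good (f n)" and i: "\<And>n. i n \<notin> f n" "\<And>n. f (Suc n) = insert (i n) (f n)"
    by metis
  have mono: "f m \<subseteq> f n" if "m \<le> n" for m n
    using that by (rule lift_Suc_mono_le[rotated]) (use i(2) in auto)
  have mem: "i m \<in> f n" if "m < n" for m n
    using mono[of "Suc m" n] i(2)[of m] that by auto
  have "inj i"
    by (rule linorder_injI) (metis i(1) mem)
  have inI: "i n \<in> I" for n
    using f[of "Suc n"] i(2)[of n] by (auto simp: good_def)
  have "topspace X \<inter> \<Inter>(range (\<lambda>n. U (i n))) \<noteq> {}"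
  proof -
    have "\<Inter>\<F> \<noteq> {}" if \<F>: "finite \<F>" "\<F> \<subseteq> range (\<lambda>n. U (i n))" for \<F>
    proof -
      obtain N where N: "finite N" "\<F> = (\<lambda>n. U (i n)) ` N"
        using finite_subset_image[OF \<F>] by blast
      obtain m where m: "\<And>n. n \<in> N \<Longrightarrow> n < m"
        using N(1) by (meson finite_nat_set_iff_bounded)
      \<comment> \<open>A point of \<open>T (insert j (f m))\<close> lies in \<open>U (i n)\<close>
        for all \<open>n < m\<close>, since these \<open>i n\<close> belong to
        \<open>f m\<close>.\<close>
      have "{j\<in>I. T (insert j (f m)) \<noteq> {}} \<noteq> {}"
        using f[of m] by (metis (no_types) countable_empty good_def)
      then obtain j y where "y \<in> T (insert j (f m))" by blast
      then have "y \<in> U (i n)" if "n \<in> N" for n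
        using mem[OF m[OF that]] by (auto simp: T_def)
      then show ?thesis using N by blast
    qed
    moreover have "closedin X C" if "C \<in> range (\<lambda>n. U (i n))" for C
      using that U inI by auto
    ultimately have "\<Inter>(range (\<lambda>n. U (i n))) \<noteq> {}"
      using cpt[unfolded compact_space_fip, rule_format, of "range (\<lambda>n. U (i n))"] by simp
    then obtain y where y: "y \<in> U (i n)" for n by blast
    then have "y \<in> topspace X"
      using openin_subset U inI[of 0] by blast
    with y show ?thesis by blast
  qed
  then show thesis
    using that[of i] \<open>inj i\<close> inI by auto
qed

subsection \<open>Compact subsets of the Cantor cube\<close>

lemma topspace_cantor_cube [simp]: "topspace cantor_cube = UNIV"
  by (simp add: cantor_cube_def)

lemma continuous_map_cantor_cube_coordinate:
  "continuous_map cantor_cube (discrete_topology UNIV) (\<lambda>x. x \<alpha>)"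
  unfolding cantor_cube_def by (rule continuous_map_product_projection) simp

lemma clopen_cantor_cube_finite:
  assumes "finite F"
  shows "openin cantor_cube {x. \<forall>\<alpha>\<in>F. P \<alpha> (x \<alpha>)}" "closedin cantor_cube {x. \<forall>\<alpha>\<in>F. P \<alpha> (x \<alpha>)}"
proof -
  have o: "openin cantor_cube {x. Q (x \<alpha>)}" for Q and \<alpha> :: 'a
    using openin_continuous_map_preimage[OF continuous_map_cantor_cube_coordinate[of \<alpha>], of "Collect Q"]
    by simp
  have c: "closedin cantor_cube {x. Q (x \<alpha>)}" for Q and \<alpha> :: 'a
    using closedin_continuous_map_preimage[OF continuous_map_cantor_cube_coordinate[of \<alpha>], of "Collect Q"]
    by simp
  have eq: "{x. \<forall>\<alpha>\<in>F. P \<alpha> (x \<alpha>)} = topspace cantor_cube \<inter> (\<Inter>\<alpha>\<in>F. {x. P \<alpha> (x \<alpha>)})"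
    by auto
  show "openin cantor_cube {x. \<forall>\<alpha>\<in>F. P \<alpha> (x \<alpha>)}"
    unfolding eq using assms o openin_topspace[of "cantor_cube :: ('a \<Rightarrow> bool) topology"] by (intro openin_Int_Inter) auto
  \<comment> \<open>\<open>closedin_Inter\<close> asks for a nonempty family; for
    \<open>F = {}\<close> the set is the whole space.\<close>
  show "closedin cantor_cube {x. \<forall>\<alpha>\<in>F. P \<alpha> (x \<alpha>)}"
    unfolding eq using c by (cases "F = {}") (auto intro!: closedin_Inter simp flip: topspace_cantor_cube simp del: topspace_cantor_cube)
qed

lemma openin_cantor_cube_cylinder:
  assumes "openin cantor_cube T" "x \<in> T"
  obtains F where "finite F" "{z. \<forall>\<alpha>\<in>F. z \<alpha> = x \<alpha>} \<subseteq> T"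
proof -
  obtain U where U: "finite {i. U i \<noteq> UNIV}" "x \<in> Pi\<^sub>E UNIV U" "Pi\<^sub>E UNIV U \<subseteq> T"
    using assms unfolding cantor_cube_def openin_product_topology_alt by auto
  have sub: "{z. \<forall>\<alpha>\<in>{i. U i \<noteq> UNIV}. z \<alpha> = x \<alpha>} \<subseteq> Pi\<^sub>E UNIV U"
  proof
    fix z assume z: "z \<in> {z. \<forall>\<alpha>\<in>{i. U i \<noteq> UNIV}. z \<alpha> = x \<alpha>}"
    have "z i \<in> U i" for i
      using U(2) z by (cases "U i = UNIV") (auto simp: PiE_iff)
    then show "z \<in> Pi\<^sub>E UNIV U" by (simp add: PiE_iff)
  qed
  show thesis by (rule that[OF U(1) order_trans[OF sub U(3)]])
qed

text \<open>Each point of \<open>S\<close> has a cylinder on which \<open>f\<close> stays within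
  \<open>e/2\<close> of its value there. A finite subcover involves finitely many coordinates, and
  points of \<open>S\<close> agreeing on these share a cylinder.\<close>

lemma continuous_map_finite_coordinates:
  assumes S: "compactin cantor_cube S"
    and f: "continuous_map (subtopology cantor_cube S) euclideanreal f" and "e > 0"
  obtains F where "finite F"
    "\<And>x x'. x \<in> S \<Longrightarrow> x' \<in> S \<Longrightarrow> (\<And>\<alpha>. \<alpha> \<in> F \<Longrightarrow> x \<alpha> = x' \<alpha>) \<Longrightarrow> \<bar>f x - f x'\<bar> < e"
proof -
  have "\<exists>G. finite G \<and> (\<forall>z\<in>S. (\<forall>\<alpha>\<in>G. z \<alpha> = x \<alpha>) \<longrightarrow> \<bar>f z - f x\<bar> < e/2)" if x: "x \<in> S" for x
  proof -
    have "openin (subtopology cantor_cube S) {z \<in> topspace (subtopology cantor_cube S). f z \<in> ball (f x) (e/2)}"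
      by (intro openin_continuous_map_preimage[OF f]) auto
    then obtain T where T: "openin cantor_cube T" and eq: "{z \<in> S. f z \<in> ball (f x) (e/2)} = T \<inter> S"
      by (auto simp: openin_subtopology)
    have "x \<in> T \<inter> S"
      unfolding eq[symmetric] using x \<open>e > 0\<close> by simp
    then obtain G where "finite G" "{z. \<forall>\<alpha>\<in>G. z \<alpha> = x \<alpha>} \<subseteq> T"
      using openin_cantor_cube_cylinder[OF T] by blast
    moreover from this(2) have "\<bar>f z - f x\<bar> < e/2" if "z \<in> S" "\<forall>\<alpha>\<in>G. z \<alpha> = x \<alpha>" for z
    proof -
      have "z \<in> {z \<in> S. f z \<in> ball (f x) (e/2)}"
        unfolding eq using that \<open>{z. \<forall>\<alpha>\<in>G. z \<alpha> = x \<alpha>} \<subseteq> T\<close> by auto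
      then show ?thesis by (simp add: dist_real_def abs_minus_commute)
    qed
    ultimately show ?thesis by blast
  qed
  then obtain G where G: "\<And>x. x \<in> S \<Longrightarrow> finite (G x)"
      "\<And>x z. x \<in> S \<Longrightarrow> z \<in> S \<Longrightarrow> (\<forall>\<alpha>\<in>G x. z \<alpha> = x \<alpha>) \<Longrightarrow> \<bar>f z - f x\<bar> < e/2"
    by metis
  define Cyl where "Cyl x = {z. \<forall>\<alpha>\<in>G x. z \<alpha> = x \<alpha>}" for x
  have "openin cantor_cube U" if "U \<in> Cyl ` S" for U
    using that clopen_cantor_cube_finite(1)[OF G(1)] by (auto simp: Cyl_def)
  moreover have "S \<subseteq> \<Union>(Cyl ` S)"
    by (auto simp: Cyl_def)
  ultimately obtain \<F> where "finite \<F>" "\<F> \<subseteq> Cyl ` S" "S \<subseteq> \<Union>\<F>"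
    using compactinD[OF S, of "Cyl ` S"] by auto
  then obtain N where N: "finite N" "N \<subseteq> S" "S \<subseteq> \<Union>(Cyl ` N)"
    by (metis finite_subset_image)
  show thesis
  proof
    show "finite (\<Union>x\<in>N. G x)" using N G(1) by blast
    fix x x' assume x: "x \<in> S" "x' \<in> S" and ag: "\<And>\<alpha>. \<alpha> \<in> (\<Union>x\<in>N. G x) \<Longrightarrow> x \<alpha> = x' \<alpha>"
    obtain c where c: "c \<in> N" "x \<in> Cyl c" using N x by blast
    then have "x' \<in> Cyl c" using ag by (force simp: Cyl_def)
    then have "\<bar>f x - f c\<bar> < e/2" "\<bar>f x' - f c\<bar> < e/2"
      using c N x G(2)[of c x] G(2)[of c x'] by (auto simp: Cyl_def)
    then show "\<bar>f x - f x'\<bar> < e" by linarith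
  qed
qed

text \<open>The adequate closure is the image of the compact product \<open>K \<times> UNIV\<close>
  under coordinatewise conjunction, which is continuous.\<close>

lemma compactin_adequate_closure:
  assumes "compactin cantor_cube K"
  shows "compactin cantor_cube (adequate_closure K)"
proof -
  define g :: "('a \<Rightarrow> bool) \<times> ('a \<Rightarrow> bool) \<Rightarrow> 'a \<Rightarrow> bool"
    where "g = (\<lambda>p \<alpha>. fst p \<alpha> \<and> snd p \<alpha>)"
  have "continuous_map (prod_topology cantor_cube cantor_cube) (discrete_topology UNIV)
      ((\<lambda>(a, b). a \<and> b) \<circ> (\<lambda>p. (fst p \<alpha>, snd p \<alpha>)))" for \<alpha> :: 'a
  proof (rule continuous_map_compose)
    show "continuous_map (prod_topology cantor_cube cantor_cube)
        (prod_topology (discrete_topology UNIV) (discrete_topology UNIV))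
        (\<lambda>p. (fst p \<alpha>, snd p \<alpha>))"
      using continuous_map_compose[OF continuous_map_fst continuous_map_cantor_cube_coordinate[of \<alpha>]]
        continuous_map_compose[OF continuous_map_snd continuous_map_cantor_cube_coordinate[of \<alpha>]]
      by (intro continuous_map_pairedI) (auto simp: o_def)
  qed (simp flip: prod_topology_discrete_topology)
  then have "continuous_map (prod_topology cantor_cube cantor_cube) cantor_cube g"
    unfolding g_def cantor_cube_def continuous_map_componentwise_UNIV by (simp add: o_def)
  moreover have "compactin (prod_topology cantor_cube cantor_cube) (K \<times> (UNIV :: ('a \<Rightarrow> bool) set))"
  proof -
    have "compact_space (cantor_cube :: ('a \<Rightarrow> bool) topology)"
      by (simp add: cantor_cube_def compact_space_product_topology compact_space_discrete_topology)
    then have "compactin cantor_cube (UNIV :: ('a \<Rightarrow> bool) set)"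
      by (simp add: compact_space_def)
    with assms show ?thesis by (simp add: compactin_Times)
  qed
  moreover have "g ` (K \<times> UNIV) = adequate_closure K"
  proof
    show "adequate_closure K \<subseteq> g ` (K \<times> (UNIV :: ('a \<Rightarrow> bool) set))"
    proof
      fix x assume "x \<in> adequate_closure K"
      then obtain y where "y \<in> K" "\<And>\<alpha>. x \<alpha> \<le> y \<alpha>" by (auto simp: adequate_closure_def)
      then have "x = g (y, x)" by (auto simp: g_def)
      with \<open>y \<in> K\<close> show "x \<in> g ` (K \<times> (UNIV :: ('a \<Rightarrow> bool) set))" by blast
    qed
    show "g ` (K \<times> UNIV) \<subseteq> adequate_closure K"
    proof clarify
      fix y c assume "y \<in> K"
      moreover have "\<forall>\<alpha>. g (y, c) \<alpha> \<le> y \<alpha>" by (simp add: g_def)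
      ultimately show "g (y, c) \<in> adequate_closure K"
        unfolding adequate_closure_def by blast
    qed
  qed
  ultimately show ?thesis by (metis image_compactin)
qed

text \<open>The open sets \<open>E (v, n)\<close> cover the compact product of \<open>C\<close> and
  its complement; a finite subcover gives \<open>W\<close> and a bound \<open>n\<close>. The form
  \<open>1 / real (Suc n)\<close> leaves countably many possible gaps, so that uncountably many
  algebra elements can later share one.\<close>

lemma finite_uniform_separation:
  assumes Y: "compact_space Y" and C: "closedin Y C" "openin Y C"
    and cont: "\<And>v. v \<in> V \<Longrightarrow> continuous_map Y euclideanreal (\<phi> v)"
    and sep: "\<And>y z. y \<in> C \<Longrightarrow> z \<in> topspace Y - C \<Longrightarrow> \<exists>v\<in>V. \<phi> v y \<noteq> \<phi> v z"
  obtains W n where "finite W" "W \<subseteq> V"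
    "\<And>y z. y \<in> C \<Longrightarrow> z \<in> topspace Y - C \<Longrightarrow> \<exists>v\<in>W. \<bar>\<phi> v y - \<phi> v z\<bar> > 1 / real (Suc n)"
proof -
  define E where "E = (\<lambda>(v, n). {p \<in> topspace (prod_topology Y Y). \<bar>\<phi> v (fst p) - \<phi> v (snd p)\<bar> \<in> {1 / real (Suc n)<..}})"
  have op: "openin (prod_topology Y Y) (E i)" if i: "i \<in> V \<times> UNIV" for i
  proof -
    obtain v n where vn: "i = (v, n)" "v \<in> V" using i by auto
    have "continuous_map (prod_topology Y Y) euclideanreal (\<lambda>p. \<bar>\<phi> v (fst p) - \<phi> v (snd p)\<bar>)"
      using continuous_map_compose[OF continuous_map_fst cont[OF vn(2)]]
        continuous_map_compose[OF continuous_map_snd cont[OF vn(2)]]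
      by (intro continuous_map_real_abs continuous_map_diff) (auto simp: o_def)
    then show ?thesis
      unfolding E_def vn prod.case by (rule openin_continuous_map_preimage) simp
  qed
  have cover: "C \<times> (topspace Y - C) \<subseteq> \<Union>(E ` (V \<times> UNIV))"
  proof clarify
    fix y z assume yz: "y \<in> C" "z \<in> topspace Y" "z \<notin> C"
    then obtain v where v: "v \<in> V" "\<phi> v y \<noteq> \<phi> v z" using sep by blast
    then obtain n where "1 / real (Suc n) < \<bar>\<phi> v y - \<phi> v z\<bar>"
      using reals_Archimedean[of "\<bar>\<phi> v y - \<phi> v z\<bar>"] by (auto simp: inverse_eq_divide)
    then have "(y, z) \<in> E (v, n)"
      using yz openin_subset[OF C(2)] by (auto simp: E_def)
    then show "(y, z) \<in> \<Union>(E ` (V \<times> UNIV))" using v by blast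
  qed
  have cpt: "compactin (prod_topology Y Y) (C \<times> (topspace Y - C))"
    using closedin_compact_space[OF Y] C by (simp add: compactin_Times closedin_diff)
  obtain \<F> where "finite \<F>" "\<F> \<subseteq> E ` (V \<times> UNIV)" "C \<times> (topspace Y - C) \<subseteq> \<Union>\<F>"
    using compactinD[OF cpt _ cover] imageE op by (metis (lifting))
  then obtain I where I: "finite I" "I \<subseteq> V \<times> UNIV" "C \<times> (topspace Y - C) \<subseteq> \<Union>(E ` I)"
    by (metis finite_subset_image)
  obtain n where n: "\<And>k. k \<in> snd ` I \<Longrightarrow> k \<le> n"
    using I(1) by (meson finite_imageI finite_nat_set_iff_bounded_le)
  show thesis
  proof
    show "finite (fst ` I)" "fst ` I \<subseteq> V" using I by auto
    fix y z assume "y \<in> C" "z \<in> topspace Y - C"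
    then obtain v k where vk: "(v, k) \<in> I" "(y, z) \<in> E (v, k)" using I(3) by fastforce
    have "1 / real (Suc n) \<le> 1 / real (Suc k)"
      using n[of k] vk(1) by (force simp: divide_simps)
    then have "\<bar>\<phi> v y - \<phi> v z\<bar> > 1 / real (Suc n)"
      using vk(2) by (simp add: E_def)
    with vk(1) show "\<exists>v\<in>fst ` I. \<bar>\<phi> v y - \<phi> v z\<bar> > 1 / real (Suc n)" by force
  qed
qed

text \<open>The ccc gives one \<open>y\<close> in \<open>K\<close> above infinitely many
  \<open>w i\<close> on their sets \<open>F i\<close>. A point glued from these pieces and
  \<open>z\<close> stays below \<open>y\<close>, hence in the adequate closure. The choices do not
  interfere, since the \<open>F i\<close> meet only in \<open>R\<close>, where all prescribed values
  coincide.\<close>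

lemma adequate_closure_independent_sequence:
  assumes K: "compactin cantor_cube K" "ccc_space (subtopology cantor_cube K)"
    and J: "uncountable J" and fin: "\<And>i. i \<in> J \<Longrightarrow> finite (F i)"
    and R: "\<And>i. i \<in> J \<Longrightarrow> R \<subseteq> F i" "pairwise (\<lambda>i j. F i \<inter> F j = R) J"
    and z: "\<And>\<alpha>. z \<alpha> \<Longrightarrow> \<alpha> \<in> R"
    and w: "\<And>i. i \<in> J \<Longrightarrow> w i \<in> adequate_closure K" "\<And>i \<alpha>. i \<in> J \<Longrightarrow> \<alpha> \<in> R \<Longrightarrow> w i \<alpha> = z \<alpha>"
  obtains s :: "nat \<Rightarrow> 'i" where "range s \<subseteq> J"
    "\<And>A. \<exists>x\<in>adequate_closure K. \<forall>n. \<forall>\<alpha>\<in>F (s n). x \<alpha> = (if n \<in> A then w (s n) \<alpha> else z \<alpha>)"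
proof -
  define U where "U i = {y. \<forall>\<alpha>\<in>F i. w i \<alpha> \<longrightarrow> y \<alpha>} \<inter> K" for i
  have U: "openin (subtopology cantor_cube K) (U i) \<and> closedin (subtopology cantor_cube K) (U i) \<and> U i \<noteq> {}"
    if "i \<in> J" for i
  proof (intro conjI)
    show "openin (subtopology cantor_cube K) (U i)"
      unfolding U_def using clopen_cantor_cube_finite(1)[OF fin[OF that], of "\<lambda>\<alpha> b. w i \<alpha> \<longrightarrow> b"]
      by (rule openin_subtopology_Int)
    show "closedin (subtopology cantor_cube K) (U i)"
      unfolding U_def closedin_subtopology
      using clopen_cantor_cube_finite(2)[OF fin[OF that], of "\<lambda>\<alpha> b. w i \<alpha> \<longrightarrow> b"] by blast
    show "U i \<noteq> {}"
      using w(1)[OF that] by (auto simp: U_def adequate_closure_def)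
  qed
  obtain y and s :: "nat \<Rightarrow> 'i" where s: "inj s" "range s \<subseteq> J"
    and yK: "y \<in> topspace (subtopology cantor_cube K)" and yU: "\<And>n. y \<in> U (s n)"
  proof (rule ccc_infinitely_many_with_common_point[OF K(2) compact_space_subtopology[OF K(1)] J U])
    fix y and s :: "nat \<Rightarrow> 'i"
    assume "inj s" "range s \<subseteq> J" "y \<in> topspace (subtopology cantor_cube K)" "\<And>n. y \<in> U (s n)"
    then show thesis by (rule that)
  qed
  then have y: "y \<in> K" "\<And>n. y \<in> U (s n)" by simp_all
  have sJ: "s n \<in> J" for n using s(2) by auto
  have "\<exists>x\<in>adequate_closure K. \<forall>n. \<forall>\<alpha>\<in>F (s n). x \<alpha> = (if n \<in> A then w (s n) \<alpha> else z \<alpha>)" for A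
  proof -
    define x where "x \<alpha> \<longleftrightarrow> z \<alpha> \<or> (\<exists>n\<in>A. \<alpha> \<in> F (s n) \<and> w (s n) \<alpha>)" for \<alpha>
    have wy: "y \<alpha>" if "\<alpha> \<in> F (s n)" "w (s n) \<alpha>" for n \<alpha>
      using y(2)[of n] that by (auto simp: U_def)
    \<comment> \<open>\<open>z\<close> is below \<open>y\<close> too: it lives on \<open>R\<close>,
      where every \<open>w (s n)\<close> agrees with it, and \<open>R\<close> is contained in every
      \<open>F (s n)\<close>.\<close>
    have "x \<alpha> \<le> y \<alpha>" for \<alpha>
      using wy z w(2)[OF sJ] R(1)[OF sJ] by (fastforce simp: x_def)
    then have "x \<in> adequate_closure K"
      using y(1) by (auto simp: adequate_closure_def)
    moreover have "x \<alpha> = (if n \<in> A then w (s n) \<alpha> else z \<alpha>)" if \<alpha>: "\<alpha> \<in> F (s n)" for n \<alpha>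
    proof -
      \<comment> \<open>A coordinate of \<open>F (s n)\<close> switched on by another index
        \<open>m\<close> lies in the root, where \<open>z\<close>, \<open>w (s m)\<close> and
        \<open>w (s n)\<close> agree.\<close>
      have other: "z \<alpha>" "w (s n) \<alpha>" if "m \<noteq> n" "\<alpha> \<in> F (s m)" "w (s m) \<alpha>" for m
      proof -
        have "s m \<noteq> s n" using s(1) that(1) by (simp add: inj_eq)
        then have "\<alpha> \<in> R"
          using R(2) sJ that(2) \<alpha> unfolding pairwise_def by blast
        with that(3) show "z \<alpha>" "w (s n) \<alpha>" using w(2) sJ by auto
      qed
      have zw: "w (s n) \<alpha>" if "z \<alpha>" using that z w(2)[OF sJ] by blast
      show ?thesis
      proof (cases "n \<in> A")
        case True
        then have "x \<alpha> \<longleftrightarrow> w (s n) \<alpha>"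
          unfolding x_def using other(2) zw \<alpha> by metis
        with True show ?thesis by simp
      next
        case False
        then have "x \<alpha> \<longleftrightarrow> z \<alpha>"
          unfolding x_def using other(1) by metis
        with False show ?thesis by simp
      qed
    qed
    ultimately show ?thesis by blast
  qed
  with s that show thesis by blast
qed

subsection \<open>Weak* compact sets and copies of l1\<close>

lemma continuous_map_weak_star_apply:
  "continuous_map weak_star_topology euclideanreal (\<lambda>l. blinfun_apply l v)"
proof -
  have "continuous_map weak_star_topology euclideanreal ((\<lambda>g. g v) \<circ> (\<lambda>l. blinfun_apply l))"
    unfolding weak_star_topology_def
    by (intro continuous_map_pullback continuous_map_product_projection) simp
  then show ?thesis by (simp add: o_def)
qed

text \<open>Uniform boundedness by Baire category: evaluations are weak* continuous, hence bounded
  on \<open>L\<close>, so the closed sets \<open>D n\<close> cover the Banach space and one of them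
  contains a ball.\<close>

lemma bounded_weak_star_compact:
  fixes L :: "('x::banach \<Rightarrow>\<^sub>L real) set"
  assumes L: "compactin weak_star_topology L"
  obtains M where "M > 0" "\<And>l. l \<in> L \<Longrightarrow> norm l \<le> M"
proof -
  define D where "D n = {v::'x. \<forall>l\<in>L. \<bar>blinfun_apply l v\<bar> \<le> real n}" for n
  have "closed (D n)" for n
  proof -
    have "D n = (\<Inter>l\<in>L. {v. \<bar>blinfun_apply l v\<bar> \<le> real n})"
      by (auto simp: D_def)
    moreover have "closed \<dots>"
      by (intro closed_INT ballI closed_Collect_le) (auto intro!: continuous_on_rabs[OF linear_continuous_on] blinfun.bounded_linear_right)
    ultimately show ?thesis by simp
  qed
  moreover have "\<Union>(range D) = UNIV"
  proof -
    have "\<exists>n. v \<in> D n" for v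
    proof -
      have "compact ((\<lambda>l. blinfun_apply l v) ` L)"
        using image_compactin[OF L continuous_map_weak_star_apply[of v]] by simp
      then obtain a where "\<And>l. l \<in> L \<Longrightarrow> \<bar>blinfun_apply l v\<bar> \<le> a"
        using compact_imp_bounded by (fastforce simp: bounded_iff)
      moreover obtain n where "a \<le> real n" using real_arch_simple by blast
      ultimately have "v \<in> D n" by (force simp: D_def)
      then show ?thesis by blast
    qed
    then show ?thesis by blast
  qed
  moreover have "euclidean interior_of T = interior T" for T :: "'x set"
    by (auto simp: interior_of_def interior_def)
  ultimately obtain n where "interior (D n) \<noteq> {}"
    using Baire_category_alt[of "euclidean :: 'x topology" "range D"] completely_metrizable_space_euclidean
    by auto
  then obtain v0 e where e: "e > 0" "cball v0 e \<subseteq> D n"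
    by (metis ex_in_conv mem_interior_cball)
  have "norm l \<le> 2 * real n / e" if l: "l \<in> L" for l
  proof (rule norm_blinfun_bound)
    show "0 \<le> 2 * real n / e" using e by simp
    fix v :: 'x
    show "norm (blinfun_apply l v) \<le> 2 * real n / e * norm v"
    proof (cases "v = 0")
      case False
      \<comment> \<open>\<open>v\<close> is rescaled to length \<open>e\<close>, so that
        \<open>v0 + w\<close> and \<open>v0\<close> both lie in the ball; their two bounds add up to
        \<open>2 * real n\<close>.\<close>
      define w where "w = (e / norm v) *\<^sub>R v"
      have mem: "v0 + w \<in> cball v0 e" "v0 \<in> cball v0 e"
        using e False by (auto simp: w_def dist_norm)
      then have "\<bar>blinfun_apply l (v0 + w)\<bar> \<le> real n" "\<bar>blinfun_apply l v0\<bar> \<le> real n"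
        using subsetD[OF e(2) mem(1)] subsetD[OF e(2) mem(2)] l by (auto simp: D_def)
      then have "\<bar>blinfun_apply l w\<bar> \<le> 2 * real n"
        by (simp add: blinfun.add_right)
      then have "e / norm v * \<bar>blinfun_apply l v\<bar> \<le> 2 * real n"
        using e by (simp add: w_def blinfun.scaleR_right abs_mult)
      then show ?thesis using e False by (simp add: field_simps)
    qed simp
  qed
  \<comment> \<open>Adding 1 keeps the bound positive even when \<open>n = 0\<close>.\<close>
  then show thesis
    using that[of "2 * real n / e + 1"] e by (force intro: add_nonneg_pos)
qed

text \<open>The independent sequence behaves like the unit vector basis of l1. The upper estimate is
  the triangle inequality; the lower one tests \<open>T a\<close> against a difference of two
  functionals adapted to the signs of \<open>a\<close>.\<close>

lemma contains_ell1_if_independent: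
  fixes v :: "nat \<Rightarrow> 'x::banach" and p q M N :: real
  assumes N: "\<And>n. norm (v n) \<le> N" and "p < q" and "M > 0"
    and ind: "\<And>A. \<exists>l :: 'x \<Rightarrow>\<^sub>L real. norm l \<le> M \<and> (\<forall>n\<in>A. q < blinfun_apply l (v n)) \<and> (\<forall>n. n \<notin> A \<longrightarrow> blinfun_apply l (v n) < p)"
  shows "contains_ell1 TYPE('x)"
proof -
  define T where "T a = (\<Sum>n. a n *\<^sub>R v n)" for a
  have le: "norm (a n *\<^sub>R v n) \<le> N * \<bar>a n\<bar>" for a n
    using mult_left_mono[OF N[of n] abs_ge_zero[of "a n"]] by (simp add: mult.commute)
  have sn: "summable (\<lambda>n. norm (a n *\<^sub>R v n))" if "a \<in> ell1" for a
  proof (rule summable_comparison_test')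
    show "summable (\<lambda>n. N * \<bar>a n\<bar>)"
      using that by (intro summable_mult) (simp add: ell1_def)
    show "norm (norm (a n *\<^sub>R v n)) \<le> N * \<bar>a n\<bar>" if "n \<ge> 0" for n
      using le[of a n] by simp
  qed
  have s: "summable (\<lambda>n. a n *\<^sub>R v n)" if "a \<in> ell1" for a
    by (rule summable_norm_cancel[OF sn[OF that]])
  have add: "T (\<lambda>n. a n + b n) = T a + T b" if "a \<in> ell1" "b \<in> ell1" for a b
    using suminf_add[OF s[OF that(1)] s[OF that(2)]] by (simp add: T_def scaleR_add_left)
  have scale: "T (\<lambda>n. r * a n) = r *\<^sub>R T a" if "a \<in> ell1" for a r
    using suminf_scaleR_right[OF s[OF that], of r] by (simp add: T_def)
  have upper: "norm (T a) \<le> N * ell1_norm a" if a: "a \<in> ell1" for a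
  proof -
    have "norm (T a) \<le> (\<Sum>n. norm (a n *\<^sub>R v n))"
      unfolding T_def by (rule summable_norm[OF sn[OF a]])
    also have "\<dots> \<le> (\<Sum>n. N * \<bar>a n\<bar>)"
      using a le sn by (intro suminf_le) (auto simp: ell1_def intro!: summable_mult)
    also have "\<dots> = N * ell1_norm a"
      using a by (simp add: ell1_norm_def ell1_def suminf_mult)
    finally show ?thesis .
  qed
  have lower: "(q - p) / (2 * M) * ell1_norm a \<le> norm (T a)" if a: "a \<in> ell1" for a
  proof -
    define A where "A = {n. a n > 0}"
    \<comment> \<open>On \<open>v n\<close> the difference \<open>k - l\<close> exceeds
      \<open>q - p\<close> for \<open>n\<close> in \<open>A\<close> and is below
      \<open>p - q\<close> otherwise, so it has the sign of \<open>a n\<close> wherever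
      \<open>a n\<close> is nonzero. This holds wherever \<open>p\<close> and \<open>q\<close> lie
      relative to 0, and costs a factor 2 in the norm.\<close>
    obtain k l where k: "norm k \<le> M" "\<forall>n\<in>A. q < blinfun_apply k (v n)" "\<forall>n. n \<notin> A \<longrightarrow> blinfun_apply k (v n) < p"
      and l: "norm l \<le> M" "\<forall>n\<in>-A. q < blinfun_apply l (v n)" "\<forall>n. n \<notin> -A \<longrightarrow> blinfun_apply l (v n) < p"
      using ind[of A] ind[of "- A"] by blast
    have bl: "bounded_linear (blinfun_apply (k - l))" by (rule blinfun.bounded_linear_right)
    have eq: "blinfun_apply (k - l) (T a) = (\<Sum>n. a n * blinfun_apply (k - l) (v n))"
      using bounded_linear.suminf[OF bl s[OF a]] by (simp add: T_def blinfun.scaleR_right)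
    have sk: "summable (\<lambda>n. a n * blinfun_apply (k - l) (v n))"
      using bounded_linear.summable[OF bl s[OF a]] by (simp add: blinfun.scaleR_right)
    have "(q - p) * ell1_norm a = (\<Sum>n. (q - p) * \<bar>a n\<bar>)"
      using a by (simp add: ell1_norm_def ell1_def suminf_mult)
    also have "\<dots> \<le> (\<Sum>n. a n * blinfun_apply (k - l) (v n))"
    proof (rule suminf_le)
      fix n
      show "(q - p) * \<bar>a n\<bar> \<le> a n * blinfun_apply (k - l) (v n)"
      proof (cases "n \<in> A")
        case True
        then have "q - p \<le> blinfun_apply (k - l) (v n)" "a n > 0"
          using k(2) l(3) by (force simp: blinfun.diff_left A_def)+
        then show ?thesis by (simp add: mult.commute)
      next
        case False
        then have "q - p \<le> - blinfun_apply (k - l) (v n)" "a n \<le> 0"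
          using k(3) l(2) by (force simp: blinfun.diff_left A_def)+
        then have "(- a n) * (q - p) \<le> (- a n) * (- blinfun_apply (k - l) (v n))"
          by (intro mult_left_mono) auto
        then show ?thesis using \<open>a n \<le> 0\<close> by (simp add: mult.commute)
      qed
    qed (use a sk in \<open>auto simp: ell1_def intro!: summable_mult\<close>)
    also have "\<dots> \<le> norm (k - l) * norm (T a)"
      using norm_blinfun[of "k - l" "T a"] by (simp add: eq)
    also have "\<dots> \<le> 2 * M * norm (T a)"
      using norm_triangle_ineq4[of k l] k(1) l(1) by (intro mult_right_mono) auto
    finally show ?thesis using \<open>M > 0\<close> by (simp add: field_simps)
  qed
  have "(q - p) / (2 * M) > 0" using \<open>p < q\<close> \<open>M > 0\<close> by simp
  then show ?thesis
    unfolding contains_ell1_def using add scale lower upper by blast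
qed

subsection \<open>Stone spaces\<close>

lemma topspace_stone_space:
  assumes "S \<in> B"
  shows "topspace (stone_space S B) = ultrafilters S B"
  using assms unfolding stone_space_def by (auto simp: ultrafilters_def)

text \<open>The complement of the basic set of \<open>b\<close> is the basic set of
  \<open>S - b\<close>, as an ultrafilter containing both would contain \<open>{}\<close>.\<close>

lemma clopen_stone_space:
  assumes "S \<in> B" "b \<in> B" "S - b \<in> B"
  shows "openin (stone_space S B) {U \<in> ultrafilters S B. b \<in> U}"
    and "closedin (stone_space S B) {U \<in> ultrafilters S B. b \<in> U}"
proof -
  show o: "openin (stone_space S B) {U \<in> ultrafilters S B. b \<in> U}"
    unfolding stone_space_def using assms by (intro topology_generated_by_Basis) auto
  have "b \<notin> U \<longleftrightarrow> S - b \<in> U" if "U \<in> ultrafilters S B" for U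
  proof -
    have "b \<inter> (S - b) \<in> U" if "b \<in> U" "S - b \<in> U"
      using \<open>U \<in> ultrafilters S B\<close> that unfolding ultrafilters_def by blast
    then show ?thesis using that assms unfolding ultrafilters_def by auto
  qed
  then have "ultrafilters S B - {U \<in> ultrafilters S B. b \<in> U} = {U \<in> ultrafilters S B. S - b \<in> U}"
    by auto
  moreover have "openin (stone_space S B) {U \<in> ultrafilters S B. S - b \<in> U}"
    unfolding stone_space_def using assms by (intro topology_generated_by_Basis) auto
  ultimately show "closedin (stone_space S B) {U \<in> ultrafilters S B. b \<in> U}"
    using assms by (auto simp: closedin_def topspace_stone_space)
qed

lemma principal_ultrafilter:
  assumes B: "clopen_subalgebra X B" and "x \<in> topspace X"
  shows "{b \<in> B. x \<in> b} \<in> ultrafilters (topspace X) B"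
proof -
  have "a \<inter> b \<in> B" if "a \<in> B" "b \<in> B" for a b
  proof -
    have "a \<subseteq> topspace X" "b \<subseteq> topspace X"
      using B that closedin_subset unfolding clopen_subalgebra_def clopens_def by blast+
    \<comment> \<open>\<open>clopen_subalgebra\<close> lists only unions and complements;
      intersections follow by De Morgan.\<close>
    then have "a \<inter> b = topspace X - ((topspace X - a) \<union> (topspace X - b))" by auto
    moreover have "topspace X - ((topspace X - a) \<union> (topspace X - b)) \<in> B"
      using B that unfolding clopen_subalgebra_def by auto
    ultimately show ?thesis by simp
  qed
  then show ?thesis
    using assms unfolding ultrafilters_def clopen_subalgebra_def by auto
qed

text \<open>The preimage of the basic set of \<open>b\<close> is \<open>b\<close>. Along this map,
  continuous functions on the Stone space are pulled back to \<open>X\<close>.\<close>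

lemma continuous_map_principal_ultrafilter:
  assumes B: "clopen_subalgebra X B"
  shows "continuous_map X (stone_space (topspace X) B) (\<lambda>x. {b \<in> B. x \<in> b})"
  unfolding stone_space_def
proof (rule continuous_on_generated_topo)
  have B': "topspace X \<in> B" using B by (simp add: clopen_subalgebra_def)
  show "(\<lambda>x. {b \<in> B. x \<in> b}) ` topspace X \<subseteq> \<Union>{{U \<in> ultrafilters (topspace X) B. b \<in> U} |b. b \<in> B}"
    using principal_ultrafilter[OF B] B' by blast
  fix V assume "V \<in> {{U \<in> ultrafilters (topspace X) B. b \<in> U} |b. b \<in> B}"
  then obtain b where b: "b \<in> B" "V = {U \<in> ultrafilters (topspace X) B. b \<in> U}" by blast
  have "(\<lambda>x. {b \<in> B. x \<in> b}) -` V \<inter> topspace X = b \<inter> topspace X"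
    using b principal_ultrafilter[OF B] by auto
  moreover have "openin X b"
    using B b by (auto simp: clopen_subalgebra_def clopens_def)
  ultimately show "openin X ((\<lambda>x. {b \<in> B. x \<in> b}) -` V \<inter> topspace X)"
    by auto
qed

section \<open>The copy of l1 forced by an uncountable WRN subalgebra\<close>

theorem theorem5p3:
  fixes K :: "('k \<Rightarrow> bool) set"
  assumes "compactin cantor_cube K"
    and "ccc_space (subtopology cantor_cube K)"
  shows "\<not> (\<exists>B. clopen_subalgebra (subtopology cantor_cube (adequate_closure K)) B \<and>
               uncountable B \<and>
               WRN_via TYPE('x::banach) (stone_space (adequate_closure K) B))"
proof
  define S where "S = adequate_closure K"
  define X where "X = subtopology cantor_cube S"
  assume "\<exists>B. clopen_subalgebra (subtopology cantor_cube (adequate_closure K)) B \<and>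
      uncountable B \<and> WRN_via TYPE('x) (stone_space (adequate_closure K) B)"
  then obtain B where B: "clopen_subalgebra X B" "uncountable B"
    and WRN: "WRN_via TYPE('x) (stone_space S B)"
    unfolding S_def X_def by blast
  have topX: "topspace X = S" by (simp add: X_def)
  have S: "compactin cantor_cube S"
    unfolding S_def by (rule compactin_adequate_closure[OF assms(1)])
  have SB: "S \<in> B" and compl: "\<And>b. b \<in> B \<Longrightarrow> S - b \<in> B" and sub: "\<And>b. b \<in> B \<Longrightarrow> b \<subseteq> S"
    using B(1) closedin_subset[of X] topX unfolding clopen_subalgebra_def clopens_def by auto
  define Y where "Y = stone_space S B"
  have topY: "topspace Y = ultrafilters S B"
    unfolding Y_def by (rule topspace_stone_space[OF SB])
  obtain L h where no_ell1: "\<not> contains_ell1 TYPE('x)"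
    and L: "compactin (weak_star_topology :: ('x \<Rightarrow>\<^sub>L real) topology) L"
    and h: "homeomorphic_map Y (subtopology weak_star_topology L) h"
    using WRN unfolding WRN_via_def homeomorphic_space Y_def by blast
  obtain M where M: "M > 0" "\<And>l. l \<in> L \<Longrightarrow> norm l \<le> M"
    using bounded_weak_star_compact[OF L] by blast
  have cptY: "compact_space Y"
    using homeomorphic_compact_space[OF homeomorphic_map_imp_homeomorphic_space[OF h]]
      compact_space_subtopology[OF L] by simp
  have hL: "h U \<in> L" if "U \<in> topspace Y" for U
    using homeomorphic_imp_surjective_map[OF h] that by (metis Int_iff image_eqI topspace_subtopology)
  have h_inj: "inj_on h (topspace Y)"
    by (rule homeomorphic_imp_injective_map[OF h])
  define u where "u x = {b \<in> B. x \<in> b}" for x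
  have u_cont: "continuous_map X Y u"
    using continuous_map_principal_ultrafilter[OF B(1)] unfolding Y_def u_def topX .
  have u_mem: "u x \<in> topspace Y" if "x \<in> S" for x
    using principal_ultrafilter[OF B(1)] that unfolding topX topY u_def .
  \<comment> \<open>\<open>\<phi> v\<close> is evaluation at \<open>v\<close>, carried from
    \<open>L\<close> to the Stone space by \<open>h\<close>; composing with \<open>u\<close> moves
    it on to \<open>S\<close>, where coordinates are available.\<close>
  define \<phi> where "\<phi> v U = blinfun_apply (h U) v" for v U
  have \<phi>_cont: "continuous_map Y euclideanreal (\<phi> v)" for v
  proof -
    have "continuous_map Y weak_star_topology h"
      using homeomorphic_imp_continuous_map[OF h] continuous_map_in_subtopology by blast
    then show ?thesis
      using continuous_map_compose[OF _ continuous_map_weak_star_apply[of v]]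
      unfolding \<phi>_def o_def by blast
  qed
  define f where "f v x = \<phi> v (u x)" for v x
  have f_cont: "continuous_map (subtopology cantor_cube S) euclideanreal (f v)" for v
    using continuous_map_compose[OF u_cont \<phi>_cont[of v]] unfolding f_def o_def X_def .

  \<comment> \<open>Uniform separation of the elements of \<open>B\<close> from their
    complements\<close>
  have "\<exists>W n. finite W \<and> (\<forall>x\<in>b. \<forall>y\<in>S - b. \<exists>v\<in>W. \<bar>f v x - f v y\<bar> > 1 / real (Suc n))"
    if b: "b \<in> B" for b
  proof -
    let ?C = "{U \<in> ultrafilters S B. b \<in> U}"
    have C: "closedin Y ?C" "openin Y ?C"
      unfolding Y_def using clopen_stone_space[OF SB b compl[OF b]] by auto
    \<comment> \<open>\<open>h\<close> is injective, and distinct functionals differ at some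
      vector.\<close>
    have sepC: "\<exists>v\<in>UNIV. \<phi> v U \<noteq> \<phi> v U'" if "U \<in> ?C" "U' \<in> topspace Y - ?C" for U U'
    proof -
      have "h U \<noteq> h U'"
        using that topY inj_onD[OF h_inj] by blast
      then show ?thesis
        unfolding \<phi>_def by (metis UNIV_I blinfun_eqI)
    qed
    obtain W n where "finite W" "W \<subseteq> UNIV"
      and W: "\<And>U U'. U \<in> ?C \<Longrightarrow> U' \<in> topspace Y - ?C \<Longrightarrow> \<exists>v\<in>W. \<bar>\<phi> v U - \<phi> v U'\<bar> > 1 / real (Suc n)"
      using finite_uniform_separation[OF cptY C \<phi>_cont sepC] by (metis (lifting))
    have "u x \<in> ?C" if "x \<in> b" for x
      using that b sub[OF b] u_mem topY by (auto simp: u_def)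
    moreover have "u x \<in> topspace Y - ?C" if "x \<in> S - b" for x
      using that u_mem by (auto simp: u_def)
    ultimately show ?thesis
      unfolding f_def using \<open>finite W\<close> W by blast
  qed
  then obtain W n where W: "\<And>b. b \<in> B \<Longrightarrow> finite (W b)"
    and sep: "\<And>b x y. b \<in> B \<Longrightarrow> x \<in> b \<Longrightarrow> y \<in> S - b \<Longrightarrow> \<exists>v\<in>W b. \<bar>f v x - f v y\<bar> > 1 / real (Suc (n b))"
    by metis
  obtain m where unc: "uncountable {b \<in> B. n b = m}"
    using uncountable_fibre[OF B(2), of UNIV n] by auto
  define e where "e = 1 / real (Suc m)"
  have "e > 0" by (simp add: e_def)
  have "\<exists>G. finite G \<and> (\<forall>x\<in>S. \<forall>y\<in>S. (\<forall>\<alpha>\<in>G. x \<alpha> = y \<alpha>) \<longrightarrow> \<bar>f v x - f v y\<bar> < e/4)" for v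
    using continuous_map_finite_coordinates[OF S f_cont[of v], of "e/4"] \<open>e > 0\<close> by (metis zero_less_divide_iff zero_less_numeral)
  then obtain G where G: "\<And>v. finite (G v)"
    and osc: "\<And>v x y. x \<in> S \<Longrightarrow> y \<in> S \<Longrightarrow> (\<forall>\<alpha>\<in>G v. x \<alpha> = y \<alpha>) \<Longrightarrow> \<bar>f v x - f v y\<bar> < e/4"
    by metis
  \<comment> \<open>If two points of \<open>S\<close> agree on \<open>F b\<close>, every
    \<open>f v\<close> with \<open>v\<close> in \<open>W b\<close> changes by less than
    \<open>e/4\<close> between them.\<close>
  define F where "F b = (\<Union>v\<in>W b. G v)" for b
  have F: "finite (F b)" if "b \<in> B" for b
    using W[OF that] G by (simp add: F_def)

  \<comment> \<open>The Delta-system and pairs of points split over its root\<close>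
  obtain J R where J: "J \<subseteq> {b \<in> B. n b = m}" "uncountable J" and R: "finite R"
      "\<And>b. b \<in> J \<Longrightarrow> R \<subseteq> F b" "pairwise (\<lambda>a b. F a \<inter> F b = R) J"
    using delta_system[OF unc, of F] F by blast
  define ind where "ind r = (\<lambda>\<alpha>. \<alpha> \<in> r)" for r :: "'k set"
  \<comment> \<open>The points \<open>ind r\<close> and \<open>w\<close> agree on \<open>R\<close>,
    the first vanishes off \<open>R\<close>, and \<open>b\<close> contains exactly one of
    them.\<close>
  define splits where "splits b r w \<longleftrightarrow> r \<subseteq> R \<and> w \<in> S \<and> (\<forall>\<alpha>\<in>R. w \<alpha> \<longleftrightarrow> \<alpha> \<in> r) \<and> (ind r \<in> b \<longleftrightarrow> w \<notin> b)" for b r w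
  define J' where "J' = {b \<in> J. \<exists>r w. splits b r w}"
  \<comment> \<open>If \<open>b\<close> has no splitting pair, membership of a point of
    \<open>S\<close> in \<open>b\<close> depends only on its trace on \<open>R\<close>. Such a
    \<open>b\<close> is determined by a set of subsets of the finite set \<open>R\<close>, so there
    are finitely many.\<close>
  have "uncountable J'"
  proof
    assume "countable J'"
    then have "uncountable (J - J')"
      using J(2) by (simp add: uncountable_minus_countable)
    moreover have "finite (J - J')"
    proof (rule inj_on_finite)
      show "inj_on (\<lambda>b. {r \<in> Pow R. ind r \<in> b}) (J - J')"
      proof (rule inj_onI)
        fix b c assume b: "b \<in> J - J'" and c: "c \<in> J - J'"
          and eq: "{r \<in> Pow R. ind r \<in> b} = {r \<in> Pow R. ind r \<in> c}"
        have mem: "x \<in> a \<longleftrightarrow> ind {\<alpha> \<in> R. x \<alpha>} \<in> a" if "x \<in> S" "a \<in> J - J'" for x a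
        proof -
          have "\<not> splits a {\<alpha> \<in> R. x \<alpha>} x" using that(2) by (auto simp: J'_def)
          then show ?thesis using that(1) by (auto simp: splits_def)
        qed
        have "ind {\<alpha> \<in> R. x \<alpha>} \<in> b \<longleftrightarrow> ind {\<alpha> \<in> R. x \<alpha>} \<in> c" for x
          using eq by blast
        then have "x \<in> b \<longleftrightarrow> x \<in> c" if "x \<in> S" for x
          using mem[OF that b] mem[OF that c] by simp
        moreover have "b \<subseteq> S" "c \<subseteq> S" using b c J(1) sub by auto
        ultimately show "b = c" by blast
      qed
      show "(\<lambda>b. {r \<in> Pow R. ind r \<in> b}) ` (J - J') \<subseteq> Pow (Pow R)" by auto
      show "finite (Pow (Pow R))" using R(1) by simp
    qed
    ultimately show False using countable_finite by blast
  qed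
  \<comment> \<open>\<open>ind r\<close> lies below \<open>w\<close>, and \<open>S\<close> is closed
    downwards.\<close>
  have indS: "ind r \<in> S" if sp: "splits b r w" for b r w
  proof -
    obtain y where "y \<in> K" "\<And>\<alpha>. w \<alpha> \<le> y \<alpha>"
      using sp unfolding splits_def S_def adequate_closure_def by blast
    moreover from this sp have "ind r \<alpha> \<le> y \<alpha>" for \<alpha>
      by (fastforce simp: ind_def splits_def)
    ultimately show ?thesis by (auto simp: S_def adequate_closure_def)
  qed
  \<comment> \<open>The triple ranges over a countable set, so uncountably many \<open>b\<close>
    will share it. The inequalities are demanded of all points agreeing on \<open>F b\<close> with
    \<open>ind r\<close> or \<open>w\<close>, because the glued points are known to agree with these
    only there.\<close>
  define type where "type b = (\<lambda>(r, N :: nat, p :: rat) w v. splits b r w \<and> norm v \<le> real N \<and>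
      (\<forall>x\<in>S. (\<forall>\<alpha>\<in>F b. x \<alpha> = ind r \<alpha>) \<longrightarrow> f v x < of_rat p) \<and>
      (\<forall>x\<in>S. (\<forall>\<alpha>\<in>F b. x \<alpha> = w \<alpha>) \<longrightarrow> of_rat p + e/4 < f v x))" for b
  have "\<exists>c w v. c \<in> Pow R \<times> UNIV \<and> type b c w v" if b: "b \<in> J'" for b
  proof -
    have bB: "b \<in> B" "n b = m" using b J(1) by (auto simp: J'_def)
    obtain r w where rw: "splits b r w" using b by (auto simp: J'_def)
    have S': "ind r \<in> S" "w \<in> S" using indS[OF rw] rw by (auto simp: splits_def)
    obtain v where v: "v \<in> W b" "\<bar>f v w - f v (ind r)\<bar> > e"
    proof (cases "ind r \<in> b")
      case True
      then show thesis
        using sep[OF bB(1), of "ind r" w] rw S' that bB(2) by (force simp: splits_def e_def abs_minus_commute)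
    next
      case False
      then show thesis
        using sep[OF bB(1), of w "ind r"] rw S' that bB(2) by (force simp: splits_def e_def)
    qed
    \<comment> \<open>The sign is chosen so that the larger value is taken at
      \<open>w\<close>.\<close>
    define v' where "v' = (if f v w > f v (ind r) then v else - v)"
    have f_minus: "f (- v) x = - f v x" for x
      by (simp add: f_def \<phi>_def blinfun.minus_right)
    have gap: "f v' w > f v' (ind r) + e"
      using v(2) by (auto simp: v'_def f_minus)
    have osc': "\<bar>f v' x - f v' y\<bar> < e/4" if "x \<in> S" "y \<in> S" "\<forall>\<alpha>\<in>F b. x \<alpha> = y \<alpha>" for x y
    proof -
      have "\<bar>f v x - f v y\<bar> < e/4"
        using that v(1) by (intro osc) (auto simp: F_def)
      then show ?thesis by (auto simp: v'_def f_minus abs_minus_commute)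
    qed
    obtain N :: nat where N: "norm v' \<le> real N" using real_arch_simple by blast
    \<comment> \<open>With oscillation below \<open>e/4\<close>, values near \<open>ind r\<close>
      stay below \<open>p\<close>, while values near \<open>w\<close> exceed
      \<open>f v' (ind r) + 3e/4\<close>, hence \<open>p + e/4\<close>.\<close>
    obtain p :: rat where p: "f v' (ind r) + e/4 < of_rat p" "of_rat p < f v' (ind r) + e/2"
      using of_rat_dense[of "f v' (ind r) + e/4" "f v' (ind r) + e/2"] \<open>e > 0\<close> by auto
    have "type b (r, N, p) w v'"
      unfolding type_def prod.case
    proof (intro conjI ballI impI)
      fix x assume x: "x \<in> S"
      show "f v' x < of_rat p" if "\<forall>\<alpha>\<in>F b. x \<alpha> = ind r \<alpha>"
        using osc'[OF x S'(1) that] p by linarith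
      show "of_rat p + e/4 < f v' x" if "\<forall>\<alpha>\<in>F b. x \<alpha> = w \<alpha>"
        using osc'[OF x S'(2) that] p gap by linarith
    qed (use rw N in auto)
    moreover have "(r, N, p) \<in> Pow R \<times> UNIV" using rw by (simp add: splits_def)
    ultimately show ?thesis by blast
  qed

  \<comment> \<open>Common data for uncountably many elements\<close>
  then obtain c w v where c: "\<And>b. b \<in> J' \<Longrightarrow> c b \<in> Pow R \<times> UNIV"
    and type: "\<And>b. b \<in> J' \<Longrightarrow> type b (c b) (w b) (v b)"
    by metis
  have "countable (Pow R \<times> (UNIV :: (nat \<times> rat) set))"
    using countable_finite[of "Pow R"] R(1) by (intro countable_SIGMA) auto
  then obtain t where t: "uncountable {b \<in> J'. c b = t}"
    by (rule uncountable_fibre[OF \<open>uncountable J'\<close> _ image_subsetI[OF c]])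
  obtain r N p where rNp: "t = (r, N, p)" by (cases t) auto
  \<comment> \<open>The shared \<open>r\<close> makes \<open>ind r\<close> a single base point for
    the gluing; the shared \<open>N\<close> and \<open>p\<close> give one norm bound and one
    threshold for the whole sequence.\<close>
  define I where "I = {b \<in> J'. c b = t}"
  have I: "type b (r, N, p) (w b) (v b)" "b \<in> J" "b \<in> B" if "b \<in> I" for b
  proof -
    have "b \<in> J'" "c b = (r, N, p)" using that rNp by (auto simp: I_def)
    then show "type b (r, N, p) (w b) (v b)" using type[of b] by simp
    show "b \<in> J" "b \<in> B" using \<open>b \<in> J'\<close> J(1) by (auto simp: J'_def)
  qed
  have split: "splits b r (w b)" if "b \<in> I" for b
    using I(1)[OF that] by (simp add: type_def)
  obtain b0 where "b0 \<in> I" using t unfolding I_def by (metis countable_empty ex_in_conv)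
  have "r \<subseteq> R" using split[OF \<open>b0 \<in> I\<close>] by (simp add: splits_def)

  \<comment> \<open>Independence of the separating vectors\<close>
  obtain s :: "nat \<Rightarrow> ('k \<Rightarrow> bool) set" where s: "range s \<subseteq> I"
    and ext: "\<And>A. \<exists>x\<in>S. \<forall>k. \<forall>\<alpha>\<in>F (s k). x \<alpha> = (if k \<in> A then w (s k) \<alpha> else ind r \<alpha>)"
  proof (rule adequate_closure_independent_sequence[OF assms, folded S_def, of I F R "ind r" w])
    show "uncountable I" using t by (simp add: I_def)
    show "pairwise (\<lambda>a b. F a \<inter> F b = R) I"
      using R(3) by (rule pairwise_subset) (use I in blast)
    show "\<And>\<alpha>. ind r \<alpha> \<Longrightarrow> \<alpha> \<in> R" using \<open>r \<subseteq> R\<close> by (auto simp: ind_def)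
    show "\<And>b. b \<in> I \<Longrightarrow> finite (F b)" using F I by blast
    show "\<And>b. b \<in> I \<Longrightarrow> R \<subseteq> F b" using R(2) I by blast
    show "\<And>b. b \<in> I \<Longrightarrow> w b \<in> S" using split by (simp add: splits_def)
    show "\<And>b \<alpha>. b \<in> I \<Longrightarrow> \<alpha> \<in> R \<Longrightarrow> w b \<alpha> = ind r \<alpha>" using split by (simp add: splits_def ind_def)
    fix s :: "nat \<Rightarrow> ('k \<Rightarrow> bool) set"
    assume "range s \<subseteq> I"
      "\<And>A. \<exists>x\<in>S. \<forall>k. \<forall>\<alpha>\<in>F (s k). x \<alpha> = (if k \<in> A then w (s k) \<alpha> else ind r \<alpha>)"
    then show thesis by (rule that)
  qed
  have sI: "s k \<in> I" for k using s by auto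
  have "contains_ell1 TYPE('x)"
  proof (rule contains_ell1_if_independent)
    show "norm (v (s k)) \<le> real N" for k
      using I(1)[OF sI] by (simp add: type_def)
    show "(of_rat p :: real) < of_rat p + e/4" using \<open>e > 0\<close> by simp
    show "M > 0" by (rule M(1))
    fix A
    obtain x where x: "x \<in> S" "\<And>k \<alpha>. \<alpha> \<in> F (s k) \<Longrightarrow> x \<alpha> = (if k \<in> A then w (s k) \<alpha> else ind r \<alpha>)"
      using ext[of A] by blast
    \<comment> \<open>The functional realising the pattern \<open>A\<close> is
      \<open>h (u x)\<close>: at \<open>v (s k)\<close> it takes the value
      \<open>f (v (s k)) x\<close>, and \<open>x\<close> agrees on \<open>F (s k)\<close> with
      \<open>w (s k)\<close> or \<open>ind r\<close>, so the inequalities in \<open>type\<close>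
      apply.\<close>
    have "norm (h (u x)) \<le> M" using M(2) hL u_mem x(1) by blast
    moreover have "of_rat p + e/4 < f (v (s k)) x" if "k \<in> A" for k
      using I(1)[OF sI[of k]] x that by (auto simp: type_def)
    moreover have "f (v (s k)) x < of_rat p" if "k \<notin> A" for k
      using I(1)[OF sI[of k]] x that by (auto simp: type_def)
    ultimately show "\<exists>l. norm l \<le> M \<and> (\<forall>k\<in>A. of_rat p + e/4 < blinfun_apply l (v (s k))) \<and>
        (\<forall>k. k \<notin> A \<longrightarrow> blinfun_apply l (v (s k)) < of_rat p)"
      unfolding f_def \<phi>_def by blast
  qed
  with no_ell1 show False by blast
qed

end
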